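(* Let $n\ge 0$ and $k\ge 1$ be integers. In the game Mem, if $k^2\ge n$, then $\mathcal{G}(n_k)=\left\lfloor\frac{n}{k}\right\rfloor$.
   Context: Mem is an impartial game (normal play) on a heap of tokens. A position $n_k$ (with $n\ge 0$, $k\ge 1$ integers) is a heap of $n$ tokens with memory $k$, where $k$ is the number of tokens removed by the immediately preceding move on the heap. From $n_k$ a player may move to $(n-j)_j$ for any integer $j$ with $k\le j\le n$; there are no other moves. The nim value $\mathcal{G}$ is defined recursively by $\mathcal{G}(n_k)=\operatorname{mex}\{\mathcal{G}((n-j)_j) : k\le j\le n\}$, where $\operatorname{mex}(S)$ is the least nonnegative integer not in $S$. *)

theory Defs
  imports Complex_Main
begin

definition mex :: "nat set \<Rightarrow> nat" where
  "mex S = (LEAST m. m \<notin> S)"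

text \<open>
  \<open>mem_nim n k\<close> is the nim value of the position \<open>n\<^sub>k\<close>: a heap of \<open>n\<close> tokens with memory \<open>k\<close>.
  Only \<open>k \<ge> 1\<close> gives a position of Mem. The bound \<open>max 1 k\<close> serves only to make the recursion
  well-founded at the junk value \<open>k = 0\<close>; the lemma \<open>mem_nim_rec\<close> below gives the recursion for
  all genuine positions.
\<close>

function mem_nim :: "nat \<Rightarrow> nat \<Rightarrow> nat" where
  "mem_nim n k = mex ((\<lambda>j. mem_nim (n - j) j) ` {max 1 k..n})"
  by pat_completeness auto
termination
  by (relation "measure fst") auto

declare mem_nim.simps [simp del]

lemma mem_nim_rec:
  assumes "k \<ge> 1"
  shows "mem_nim n k = mex {mem_nim (n - j) j | j. k \<le> j \<and> j \<le> n}"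
proof -
  have "(\<lambda>j. mem_nim (n - j) j) ` {max 1 k..n} = {mem_nim (n - j) j | j. k \<le> j \<and> j \<le> n}"
    using assms by auto
  then show ?thesis
    by (subst mem_nim.simps) simp
qed

end

theory Submission
  imports Defs
begin

text \<open>
  The region \<open>n \<le> k\<^sup>2\<close> is closed under moves: removing \<open>j \<ge> k\<close> tokens leaves
  \<open>n - j \<le> k\<^sup>2 \<le> j\<^sup>2\<close>. By induction the option \<open>(n - j)\<^sub>j\<close> therefore has nim value
  \<open>\<lfloor>(n - j) / j\<rfloor> = \<lfloor>n / j\<rfloor> - 1\<close>, and the nim value of \<open>n\<^sub>k\<close> is the mex of the numbers
  \<open>\<lfloor>n / j\<rfloor> - 1\<close> for \<open>k \<le> j \<le> n\<close>. All of these are less than \<open>\<lfloor>n / k\<rfloor>\<close>. Conversely, every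
  \<open>q\<close> with \<open>1 \<le> q \<le> \<lfloor>n / k\<rfloor>\<close> is a quotient \<open>\<lfloor>n / j\<rfloor>\<close>, because past \<open>\<surd>n\<close> the numbers
  \<open>n / j\<close> decrease by less than 1 at each step; \<open>div_div_self_eq\<close> gives \<open>j = \<lfloor>n / q\<rfloor>\<close> as
  an explicit choice. So the options have exactly the values \<open>0, \<dots>, \<lfloor>n / k\<rfloor> - 1\<close>.
\<close>

lemma mex_lessThan: "mex {..<m} = m"
  unfolding mex_def by (rule Least_equality) auto

text \<open>
  With \<open>j = n div q\<close>, the number \<open>n\<close> lies in the interval from \<open>q * j\<close> to \<open>q * j + q\<close>,
  right end excluded. When \<open>q \<le> j\<close> this interval ends before \<open>(q + 1) * j\<close>, so dividing by
  \<open>j\<close> returns \<open>q\<close>.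
\<close>

lemma div_div_self_eq:
  fixes n q :: nat
  assumes "q \<ge> 1" and "q \<le> n div q"
  shows "n div (n div q) = q"
proof (rule div_nat_eqI)
  show "n div q * q \<le> n"
    by simp
  have "n < q * (n div q) + q"
    using assms(1) by (metis add.commute dividend_less_times_div less_le_trans zero_less_one)
  also have "\<dots> \<le> n div q * Suc q"
    using assms(2) by (simp add: algebra_simps)
  finally show "n < n div q * Suc q" .
qed

lemma mem_nim_eq_div:
  fixes n k :: nat
  assumes "k \<ge> 1" and "n \<le> k ^ 2"
  shows "mem_nim n k = n div k"
  using assms
proof (induction n arbitrary: k rule: less_induct)
  case (less n k)
  have option_value: "mem_nim (n - j) j = n div j - 1" if "k \<le> j" "j \<le> n" for j
  proof -
    have "n - j \<le> j ^ 2"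
      using less.prems(2) power_mono[OF that(1), of 2] by linarith
    then have "mem_nim (n - j) j = (n - j) div j"
      using less.IH[of "n - j" j] less.prems(1) that by auto
    also have "\<dots> = n div j - 1"
      using that less.prems(1) by (simp add: le_div_geq)
    finally show ?thesis .
  qed
  have "{mem_nim (n - j) j | j. k \<le> j \<and> j \<le> n} = {..<n div k}"
  proof (intro equalityI subsetI)
    fix v
    assume "v \<in> {mem_nim (n - j) j | j. k \<le> j \<and> j \<le> n}"
    then obtain j where j: "k \<le> j" "j \<le> n" and v: "v = n div j - 1"
      using option_value by auto
    have "n div j \<le> n div k"
      using j(1) less.prems(1) by (intro div_le_mono2) auto
    moreover have "n div j \<ge> 1"
      using j less.prems(1) by (simp add: le_div_geq)
    ultimately show "v \<in> {..<n div k}"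
      using v by simp
  next
    fix v
    assume "v \<in> {..<n div k}"
    then have q: "Suc v \<le> n div k"
      by simp
    define j where "j = n div Suc v"
    have "Suc v * k \<le> n"
      using q less.prems(1) by (simp add: less_eq_div_iff_mult_less_eq del: mult_Suc)
    then have "k \<le> j"
      unfolding j_def by (simp add: less_eq_div_iff_mult_less_eq mult.commute del: mult_Suc)
    \<comment> \<open>The hypothesis \<open>n \<le> k\<^sup>2\<close> bounds the target quotient by \<open>k\<close>, hence by \<open>j\<close>.\<close>
    moreover have "n div k \<le> k"
      using div_le_mono[OF less.prems(2), of k] less.prems(1) by (simp add: power2_eq_square)
    ultimately have "n div j = Suc v"
      unfolding j_def using q by (intro div_div_self_eq) auto
    moreover have "j \<le> n"
      unfolding j_def by (rule div_le_dividend)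
    ultimately show "v \<in> {mem_nim (n - j) j | j. k \<le> j \<and> j \<le> n}"
      using option_value[of j] \<open>k \<le> j\<close> by force
  qed
  then show ?case
    using mem_nim_rec[OF less.prems(1)] by (simp add: mex_lessThan)
qed

theorem theorem3p1:
  fixes n k :: nat
  assumes "k \<ge> 1"
    and "k ^ 2 \<ge> n"
  shows "int (mem_nim n k) = \<lfloor>real n / real k\<rfloor>"
  using mem_nim_eq_div[OF assms] by (simp add: floor_divide_of_nat_eq)

end
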